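(* There is an absolute constant $C$ such that the following holds. Let $x\ge 2$ and let $T_1,\ldots,T_r$ be arbitrary disjoint nonempty subsets of the primes $\le x$. Let $k_1,\ldots,k_r\ge 0$ be integers and $P=\mathbb P_x(\omega(n;T_j)=k_j\ (1\le j\le r))$. Let $\eta=0$ if $T_1\cup\cdots\cup T_r$ contains every prime $\le x$ and $\eta=1$ otherwise; let $\xi=1$ if $\eta=k_1=\cdots=k_r=0$ and $\xi=0$ otherwise. Then \[ P\le C\prod_{j=1}^r\Big(\frac{H'(T_j)^{k_j}}{k_j!}\mathrm{e}^{-H(T_j)}\Big)\Big(\eta+\frac{k_1}{H'(T_1)}+\cdots+\frac{k_r}{H'(T_r)}\Big)+C\xi, \] and also \[ P\le C\prod_{j=1}^r\Big(\frac{(H(T_j)+2)^{k_j}}{k_j!}\mathrm{e}^{-H(T_j)}\Big). \]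
   Context: $\mathbb P_x$ denotes probability with respect to an integer $n$ drawn uniformly at random from $[1,x]$. For a finite set $T$ of primes, $\omega(n;T)=\#\{p\mid n:p\in T\}$, $H(T)=\sum_{p\in T}1/p$, $H'(T)=\sum_{p\in T}1/(p-1)$. *)

theory Defs
  imports "HOL-Computational_Algebra.Primes" Complex_Main
begin

definition omegaT :: "nat \<Rightarrow> nat set \<Rightarrow> nat" where
  "omegaT n T = card {p \<in> T. prime p \<and> p dvd n}"

definition H :: "nat set \<Rightarrow> real" where
  "H T = (\<Sum>p\<in>T. 1 / real p)"

definition H' :: "nat set \<Rightarrow> real" where
  "H' T = (\<Sum>p\<in>T. 1 / (real p - 1))"

definition Px :: "real \<Rightarrow> (nat \<Rightarrow> bool) \<Rightarrow> real" where
  "Px x Q = real (card {n \<in> {1..nat \<lfloor>x\<rfloor>}. Q n}) / real (nat \<lfloor>x\<rfloor>)"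

end

theory Submission
  imports Defs
begin

text \<open>
  Let \<open>N = \<lfloor>x\<rfloor>\<close>. For \<open>1 < n \<le> N\<close>, splitting \<open>ln N = ln (N / n) + ln n\<close> and distributing \<open>ln n\<close> over the
  prime powers exactly dividing \<open>n\<close> gives \<open>ln N \<le> \<Sum> ln (N / h)\<close>, where \<open>h\<close> runs over the cofactors
  \<open>n / p\<^sup>a\<close>. Summing over the \<open>n\<close> counted by \<open>P\<close> and exchanging the order of summation, Chebyshev's bound
  \<open>O(y / ln y)\<close> for the number of prime powers up to \<open>y\<close> leaves \<open>O(N) \<Sum> 1 / h\<close>. Here \<open>h\<close> satisfies the same
  constraints as \<open>n\<close>, except that one \<open>k j\<close> has dropped by one if \<open>p \<in> T j\<close>; this is the source of the factors
  \<open>k j / H' (T j)\<close>, and of \<open>\<eta>\<close> for the primes outside all \<open>T j\<close>. The sum over \<open>h\<close> is bounded by an Euler product,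
  and Mertens' estimate for the remaining primes yields \<open>O(ln N) exp (- \<Sum> H (T j))\<close>. The second bound
  follows from the first by \<open>H' \<le> H + 1\<close> and Bernoulli's inequality.
\<close>

subsection \<open>Chebyshev and Mertens upper bounds\<close>

lemma prod_primes_dvd:
  fixes A :: "nat set"
  assumes "finite A" "\<And>p. p \<in> A \<Longrightarrow> prime p" "\<And>p. p \<in> A \<Longrightarrow> p dvd n"
  shows "\<Prod>A dvd n"
  using assms
proof (induction A rule: finite_induct)
  case (insert p A)
  have "coprime p (\<Prod>A)"
    using insert by (intro prod_coprime_right) (auto intro: primes_coprime)
  with insert show ?case
    by (auto intro: divides_mult)
qed auto

text \<open>Row \<open>2 * n + 1\<close> has two equal middle entries, so each is at most half of
  the row sum \<open>2 * 4 ^ n\<close>.\<close>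

lemma choose_odd_middle_le: "(2 * n + 1) choose n \<le> 4 ^ n"
proof -
  have "(2 * n + 1 choose n) + (2 * n + 1 choose (n + 1)) = (\<Sum>k\<in>{n, n+1}. 2 * n + 1 choose k)"
    by simp
  also have "\<dots> \<le> (\<Sum>k\<le>2*n+1. 2 * n + 1 choose k)"
    by (intro sum_mono2) auto
  also have "\<dots> = 2 * 4 ^ n"
    by (simp only: choose_row_sum) (simp add: power_mult)
  finally show ?thesis
    using binomial_symmetric[of n "2*n+1"] by simp
qed

lemma finite_primes_le [simp]: "finite {p::nat. prime p \<and> p \<le> n}"
  by (rule finite_subset[of _ "{..n}"]) auto

text \<open>Erdos's argument. An even \<open>n > 2\<close> adds no prime. For
  \<open>n = 2 * m + 1\<close> the primes up to \<open>m + 1\<close> fall under the induction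
  hypothesis, and the larger ones all divide one middle binomial coefficient.\<close>

lemma primorial_le: "\<Prod>{p. prime p \<and> p \<le> n} \<le> (4::nat) ^ n"
proof (induction n rule: less_induct)
  case (less n)
  consider "n \<le> 1" | "n = 2" | "n > 2" "even n" | m where "n = 2 * m + 1" "m > 0"
  proof (cases "odd n")
    case True
    then obtain m where "n = 2 * m + 1" by (rule oddE)
    with that(1,4) show ?thesis by (cases "m = 0") auto
  qed (use that(1-3) in linarith)
  then show ?case
  proof cases
    case 1
    then have empty: "{p. prime p \<and> p \<le> n} = {}"
      by (auto dest: prime_ge_2_nat)
    show ?thesis unfolding empty by simp
  next
    case 2
    then have "{p. prime p \<and> p \<le> n} = {2}"
      by (auto dest: prime_ge_2_nat)
    then show ?thesis using 2 by simp
  next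
    case 3
    then have "\<not> prime n"
      using prime_odd_nat by auto
    then have "p \<le> n \<longleftrightarrow> p \<le> n - 1" if "prime p" for p
      using 3 that by (cases "p = n") auto
    then have "{p. prime p \<and> p \<le> n} = {p. prime p \<and> p \<le> n - 1}"
      by blast
    also have "\<Prod>\<dots> \<le> 4 ^ (n - 1)"
      using 3 by (intro less) auto
    also have "\<dots> \<le> 4 ^ n"
      by (intro power_increasing) auto
    finally show ?thesis .
  next
    case 4
    let ?B = "{p. prime p \<and> m + 1 < p \<and> p \<le> 2 * m + 1}"
    have finB: "finite ?B"
      by (rule finite_subset[OF _ finite_primes_le[of "2*m+1"]]) auto
    \<comment> \<open>A prime in \<open>?B\<close> divides \<open>(2m+1)!\<close> but neither
      \<open>m!\<close> nor \<open>(m+1)!\<close>, so it survives in the quotient.\<close>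
    have "\<Prod>?B dvd (2 * m + 1 choose m)"
    proof (rule prod_primes_dvd)
      show "finite ?B" by fact
      fix p assume p: "p \<in> ?B"
      then have "p dvd fact (2 * m + 1)"
        by (simp add: prime_dvd_fact_iff del: fact_Suc)
      also have "fact (2 * m + 1) = fact m * fact (m + 1) * (2 * m + 1 choose m)"
        using binomial_fact_lemma[of m "2*m+1"] by (simp add: Suc_diff_le)
      finally show "p dvd (2 * m + 1 choose m)"
        using p by (simp add: prime_dvd_mult_iff prime_dvd_fact_iff del: fact_Suc)
    qed auto
    then have B: "\<Prod>?B \<le> 4 ^ m"
      by (intro order.trans[OF dvd_imp_le choose_odd_middle_le]) auto
    have split: "{p. prime p \<and> p \<le> n} = {p. prime p \<and> p \<le> m + 1} \<union> ?B"
      using 4 by auto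
    have "\<Prod>{p. prime p \<and> p \<le> n} = \<Prod>{p. prime p \<and> p \<le> m + 1} * \<Prod>?B"
      unfolding split
    proof (rule prod.union_disjoint[OF finite_primes_le finB])
      show "{p. prime p \<and> p \<le> m + 1} \<inter> ?B = {}" by fastforce
    qed
    also have "\<dots> \<le> 4 ^ (m + 1) * 4 ^ m"
    proof (rule mult_le_mono[OF less.IH B])
      show "m + 1 < n" using 4 by linarith
    qed
    also have "\<dots> = 4 ^ n"
      using 4 by (simp add: power_add mult_2)
    finally show ?thesis .
  qed
qed

lemma sum_ln_primes_le: "(\<Sum>p | prime p \<and> p \<le> n. ln (real p)) \<le> real n * ln 4"
proof -
  have "(\<Sum>p | prime p \<and> p \<le> n. ln (real p)) = ln (\<Prod>p | prime p \<and> p \<le> n. real p)"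
    by (rule ln_prod[symmetric]) (auto simp: prime_gt_0_nat)
  also have "(\<Prod>p | prime p \<and> p \<le> n. real p) = real (\<Prod>{p. prime p \<and> p \<le> n})"
    by simp
  also have "ln \<dots> \<le> ln (real (4 ^ n))"
    using primorial_le[of n] by (intro ln_mono of_nat_mono) (auto intro!: prod_pos simp: prime_gt_0_nat)
  finally show ?thesis by (simp add: ln_realpow)
qed

lemma sum_ln_prime_divisors_le:
  assumes "m > 0"
  shows "(\<Sum>p | prime p \<and> p dvd m. ln (real p)) \<le> ln (real m)"
proof -
  have fin: "finite {p. prime p \<and> p dvd m}"
    using assms by (auto intro: finite_subset[OF _ finite_primes_le[of m]] dvd_imp_le)
  have "(\<Sum>p | prime p \<and> p dvd m. ln (real p)) = ln (\<Prod>p | prime p \<and> p dvd m. real p)"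
    by (rule ln_prod[symmetric]) (use fin in \<open>auto simp: prime_gt_0_nat\<close>)
  also have "(\<Prod>p | prime p \<and> p dvd m. real p) = real (\<Prod>{p. prime p \<and> p dvd m})"
    by simp
  also have "ln \<dots> \<le> ln (real m)"
    using assms fin
    by (intro ln_mono of_nat_mono dvd_imp_le prod_primes_dvd) (auto intro!: prod_pos simp: prime_gt_0_nat)
  finally show ?thesis .
qed

lemma card_multiples: "d > 0 \<Longrightarrow> card {m \<in> {1..n::nat}. d dvd m} = n div d"
proof -
  assume d: "d > 0"
  have "{m \<in> {1..n}. d dvd m} = (\<lambda>i. d * i) ` {1..n div d}"
    using d by (auto simp: image_iff elim!: dvdE simp: less_eq_div_iff_mult_less_eq mult.commute Suc_le_eq)
  moreover have "inj_on (\<lambda>i. d * i) {1..n div d}"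
    using d by (auto simp: inj_on_def)
  ultimately show ?thesis by (simp add: card_image)
qed

text \<open>Pairs \<open>p dvd m\<close> with \<open>m \<le> n\<close>, weighted by
  \<open>ln p\<close>, are counted in two ways: each \<open>p\<close> has \<open>n div p\<close>
  multiples, and each \<open>m\<close> contributes at most \<open>ln m\<close>. Replacing
  \<open>n div p\<close> by \<open>n / p\<close> costs one \<open>ln p\<close> per prime, whence the
  Chebyshev term \<open>ln 4\<close>.\<close>

lemma sum_ln_over_primes_le:
  assumes "n > 0"
  shows "(\<Sum>p | prime p \<and> p \<le> n. ln (real p) / real p) \<le> ln (real n) + ln 4"
proof -
  let ?Q = "{p. prime p \<and> p \<le> n}"
  have "(\<Sum>p\<in>?Q. ln (real p) * real (n div p)) = (\<Sum>p\<in>?Q. \<Sum>m\<in>{m\<in>{1..n}. p dvd m}. ln (real p))"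
    by (intro sum.cong refl) (use card_multiples[of _ n] in \<open>auto simp: prime_gt_0_nat\<close>)
  also have "\<dots> = (\<Sum>m\<in>{1..n}. \<Sum>p\<in>{p\<in>?Q. p dvd m}. ln (real p))"
    by (rule sum.swap_restrict) auto
  also have "\<dots> \<le> (\<Sum>m\<in>{1..n}. ln (real n))"
  proof (rule sum_mono)
    fix m assume m: "m \<in> {1..n}"
    have "{p\<in>?Q. p dvd m} = {p. prime p \<and> p dvd m}"
      using m by (auto dest: dvd_imp_le)
    then have "(\<Sum>p\<in>{p\<in>?Q. p dvd m}. ln (real p)) \<le> ln (real m)"
      using sum_ln_prime_divisors_le[of m] m by simp
    also have "\<dots> \<le> ln (real n)" using m by simp
    finally show "(\<Sum>p\<in>{p\<in>?Q. p dvd m}. ln (real p)) \<le> ln (real n)" .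
  qed
  finally have 1: "(\<Sum>p\<in>?Q. ln (real p) * real (n div p)) \<le> real n * ln (real n)"
    by simp
  have "real n * (\<Sum>p\<in>?Q. ln (real p) / real p) = (\<Sum>p\<in>?Q. ln (real p) * (real n / real p))"
    by (simp add: sum_distrib_left mult_ac)
  also have "\<dots> \<le> (\<Sum>p\<in>?Q. ln (real p) * (real (n div p) + 1))"
  proof (intro sum_mono mult_left_mono)
    fix p assume "p \<in> ?Q"
    then have p: "p > 1" by (auto dest: prime_gt_1_nat)
    show "real n / real p \<le> real (n div p) + 1"
      using floor_divide_of_nat_eq[of n p, where ?'a = real] by linarith
    show "ln (real p) \<ge> 0" using p by simp
  qed
  also have "\<dots> \<le> real n * (ln (real n) + ln 4)"
    using 1 sum_ln_primes_le[of n] by (simp add: algebra_simps sum.distrib)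
  finally show ?thesis using assms by simp
qed

text \<open>Abel summation in inductive form: the surplus of the partial sums of \<open>b\<close>
  over those of \<open>a\<close>, multiplied by the latest and hence smallest weight, bounds the
  weighted surplus from below.\<close>

lemma weighted_sum_mono_partial_sums:
  fixes a b f :: "nat \<Rightarrow> real"
  assumes f0: "\<And>n. n \<ge> m \<Longrightarrow> f n \<ge> 0" and dec: "\<And>n. n \<ge> m \<Longrightarrow> f (Suc n) \<le> f n"
    and part: "\<And>n. n \<ge> m \<Longrightarrow> (\<Sum>i=m..n. a i) \<le> (\<Sum>i=m..n. b i)"
    and "n \<ge> m"
  shows "(\<Sum>i=m..n. a i * f i) \<le> (\<Sum>i=m..n. b i * f i)"
proof -
  have "f n * (\<Sum>i=m..n. b i - a i) \<le> (\<Sum>i=m..n. (b i - a i) * f i)"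
    using \<open>n \<ge> m\<close>
  proof (induction n rule: dec_induct)
    case (step n)
    have "f (Suc n) * (\<Sum>i=m..n. b i - a i) \<le> f n * (\<Sum>i=m..n. b i - a i)"
      using step dec part by (intro mult_right_mono) (auto simp: sum_subtractf)
    also note step.IH
    finally show ?case using step by (simp add: algebra_simps)
  qed simp
  moreover have "0 \<le> f n * (\<Sum>i=m..n. b i - a i)"
    using assms by (intro mult_nonneg_nonneg) (auto simp: sum_subtractf)
  ultimately show ?thesis by (simp add: algebra_simps sum_subtractf)
qed

text \<open>For consecutive logarithms \<open>v\<close> and \<open>u\<close>, applying
  \<open>ln t \<le> t - 1\<close> at \<open>t = v / u\<close> bounds the summand by
  \<open>ln u - ln v\<close>.\<close>

lemma sum_ln_ln_telescope:
  assumes "n \<ge> 2"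
  shows "(\<Sum>i=3..n. (ln (real i) - ln (real (i - 1))) / ln (real i)) \<le> ln (ln (real n)) - ln (ln 2)"
  using assms
proof (induction n rule: dec_induct)
  case (step n)
  define u v where "u = ln (real (Suc n))" and "v = ln (real n)"
  have uv: "u > 0" "v > 0" using step by (auto simp: u_def v_def)
  have "ln (v / u) \<le> v / u - 1" using uv by (intro ln_le_minus_one) auto
  then have "(u - v) / u \<le> ln u - ln v"
    using uv by (simp add: ln_div field_simps)
  with step show ?case by (simp add: u_def v_def)
qed simp

text \<open>Partial summation turns the bound on the sum of \<open>ln p / p\<close> into one on the
  sum of \<open>1 / p\<close>, with weights \<open>1 / ln i\<close>.\<close>

lemma sum_inverse_primes_le:
  "\<exists>C. \<forall>n\<ge>2. H {p. prime p \<and> p \<le> n} \<le> ln (ln (real n)) + C"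
proof (intro exI allI impI)
  fix n :: nat assume n: "n \<ge> 2"
  define a where "a = (\<lambda>i::nat. if prime i then ln (real i) / real i else 0)"
  \<comment> \<open>The value at \<open>2\<close> is chosen so that the partial sums of
    \<open>b\<close> telescope to exactly \<open>ln m + ln 4\<close>, the known bound for those of
    \<open>a\<close>.\<close>
  define b where "b = (\<lambda>i::nat. if i = 2 then ln 2 + ln 4 else ln (real i) - ln (real (i - 1)))"
  define f where "f = (\<lambda>i::nat. 1 / ln (real i))"
  have Q: "{p. prime p \<and> p \<le> m} = {p\<in>{2..m}. prime p}" for m :: nat
    by (auto dest: prime_ge_2_nat)
  have sumb: "(\<Sum>i=2..m. b i) = ln (real m) + ln 4" if "m \<ge> 2" for m
    using that by (induction m rule: dec_induct) (auto simp: b_def)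
  have "H {p. prime p \<and> p \<le> n} = (\<Sum>i=2..n. a i * f i)"
    unfolding H_def Q a_def f_def
    by (subst sum.inter_filter) (auto intro!: sum.cong)
  also have "\<dots> \<le> (\<Sum>i=2..n. b i * f i)"
  proof (rule weighted_sum_mono_partial_sums)
    fix m :: nat assume m: "m \<ge> 2"
    show "f m \<ge> 0" "f (Suc m) \<le> f m"
      using m by (auto simp: f_def intro!: divide_left_mono)
    have "(\<Sum>i=2..m. a i) = (\<Sum>p | prime p \<and> p \<le> m. ln (real p) / real p)"
      unfolding Q a_def by (subst sum.inter_filter) auto
    also have "\<dots> \<le> (\<Sum>i=2..m. b i)"
      using sum_ln_over_primes_le[of m] m by (simp add: sumb)
    finally show "(\<Sum>i=2..m. a i) \<le> (\<Sum>i=2..m. b i)" .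
  qed (use n in auto)
  also have "\<dots> = b 2 * f 2 + (\<Sum>i=3..n. b i * f i)"
    using sum.atLeast_Suc_atMost[OF n, of "\<lambda>i. b i * f i"] by (simp add: eval_nat_numeral)
  also have "(\<Sum>i=3..n. b i * f i) = (\<Sum>i=3..n. (ln (real i) - ln (real (i - 1))) / ln (real i))"
    by (intro sum.cong) (auto simp: b_def f_def)
  also have "\<dots> \<le> ln (ln (real n)) - ln (ln 2)"
    by (rule sum_ln_ln_telescope) fact
  finally show "H {p. prime p \<and> p \<le> n} \<le> ln (ln (real n)) + ((ln 2 + ln 4) / ln 2 - ln (ln 2))"
    by (simp add: b_def f_def)
qed

section \<open>Counting prime powers up to a bound\<close>

lemma finite_prime_powers_le: "finite {(p, a). prime p \<and> a > 0 \<and> p ^ a \<le> (m::nat)}"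
proof (rule finite_subset)
  have "p \<le> m \<and> a \<le> m" if "prime p" "a > 0" "p ^ a \<le> m" for p a
  proof -
    have "p \<ge> 2" using that by (simp add: prime_ge_2_nat)
    then have "a < p ^ a" by (intro less_exp[THEN order.strict_trans2] power_mono) auto
    moreover have "p \<le> p ^ a" using that \<open>p \<ge> 2\<close> by (intro self_le_power) auto
    ultimately show ?thesis using that by simp
  qed
  then show "{(p, a). prime p \<and> a > 0 \<and> p ^ a \<le> m} \<subseteq> {..m} \<times> {..m}" by auto
qed simp

text \<open>Follows from \<open>ln t \<le> t\<close> at the fourth root of \<open>m\<close>. It
  controls the primes up to \<open>sqrt m\<close> in the count of prime powers.\<close>

lemma sqrt_ln_square_le:
  assumes "m \<ge> (1::real)"
  shows "sqrt m * (ln m)\<^sup>2 \<le> 16 * m"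
proof -
  have "ln m = 4 * ln (sqrt (sqrt m))" using assms by (simp add: ln_sqrt)
  also have "\<dots> \<le> 4 * sqrt (sqrt m)"
    using assms ln_le_minus_one[of "sqrt (sqrt m)"] by simp
  finally have "(ln m)\<^sup>2 \<le> (4 * sqrt (sqrt m))\<^sup>2"
    using assms by (intro power_mono) auto
  also have "\<dots> = 16 * sqrt m" using assms by (simp add: power_mult_distrib)
  finally have "sqrt m * (ln m)\<^sup>2 \<le> sqrt m * (16 * sqrt m)"
    using assms by (intro mult_left_mono) auto
  also have "\<dots> = 16 * m" using assms by simp
  finally show ?thesis .
qed

text \<open>A prime \<open>p\<close> has at most \<open>ln m / ln p\<close> admissible exponents.
  The shift in \<open>ln (m + 1)\<close> lets the bound be used at \<open>m = N div h\<close>, even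
  though \<open>N / h\<close> may exceed this integer part.\<close>

lemma card_prime_powers_le:
  "\<exists>K>0. \<forall>m. real (card {(p, a). prime p \<and> a > 0 \<and> p ^ a \<le> m}) * ln (real m + 1) \<le> K * real m"
proof -
  define K :: real where "K = 2 * (16 / ln 2 + 4 * ln 4)"
  have "real (card {(p, a). prime p \<and> a > 0 \<and> p ^ a \<le> m}) * ln (real m + 1) \<le> K * real m" for m
  proof (cases "m \<ge> 2")
    case False
    have empty: "{(p, a). prime p \<and> a > 0 \<and> p ^ a \<le> m} = {}"
    proof -
      have "p ^ a \<ge> 2" if "prime p" "a > 0" for p a :: nat
        using self_le_power[of p a] prime_ge_2_nat[OF that(1)] that by linarith
      then show ?thesis using False by (auto dest: order.trans)
    qed
    show ?thesis unfolding empty by (auto simp: K_def)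
  next
    case True
    define L where "L = ln (real m)"
    have L: "L > 0" using True by (simp add: L_def)
    let ?Q = "{p. prime p \<and> p \<le> m}"
    let ?E = "\<lambda>p. {a. a > 0 \<and> p ^ a \<le> m}"
    have "p \<le> m" if "prime p" "a > 0" "p ^ a \<le> m" for p a
      using self_le_power[of p a] prime_ge_2_nat[OF that(1)] that by linarith
    then have eq: "{(p, a). prime p \<and> a > 0 \<and> p ^ a \<le> m} = Sigma ?Q ?E"
      by blast
    have E: "finite (?E p) \<and> real (card (?E p)) \<le> L / ln (real p)" if "p \<in> ?Q" for p
    proof -
      have p: "p > 1" using that by (auto dest: prime_gt_1_nat)
      have "?E p \<subseteq> {1..nat \<lfloor>L / ln (real p)\<rfloor>}"
      proof
        fix a assume a: "a \<in> ?E p"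
        then have "ln (real (p ^ a)) \<le> L"
          unfolding L_def using p True by (intro ln_mono of_nat_mono) auto
        then have "real a \<le> L / ln (real p)"
          using p by (simp add: ln_realpow field_simps)
        then show "a \<in> {1..nat \<lfloor>L / ln (real p)\<rfloor>}"
          using a by (auto simp: le_nat_floor)
      qed
      moreover from this have "card (?E p) \<le> nat \<lfloor>L / ln (real p)\<rfloor>"
        by (metis card_atLeastAtMost card_mono diff_Suc_1 finite_atLeastAtMost)
      moreover have "real (nat \<lfloor>L / ln (real p)\<rfloor>) \<le> L / ln (real p)"
        using L p by (intro of_nat_floor) auto
      ultimately show ?thesis by (meson finite_atLeastAtMost finite_subset of_nat_mono order.trans)
    qed
    \<comment> \<open>Split at \<open>sqrt m\<close>. There are at most \<open>sqrt m\<close> small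
      primes, so the crude bound \<open>ln p \<ge> ln 2\<close> suffices; for large ones
      \<open>L \<le> 2 * ln p\<close>, which reduces the sum to Chebyshev's.\<close>
    let ?s = "{p\<in>?Q. p ^ 2 \<le> m}" and ?l = "{p\<in>?Q. \<not> p ^ 2 \<le> m}"
    have "real (card (Sigma ?Q ?E)) * L = (\<Sum>p\<in>?Q. real (card (?E p)) * L)"
      using E by (subst card_SigmaI) (auto simp: sum_distrib_right)
    also have "\<dots> \<le> (\<Sum>p\<in>?Q. L / ln (real p) * L)"
      using E L by (intro sum_mono mult_right_mono) auto
    also have "\<dots> = (\<Sum>p\<in>?s. L\<^sup>2 / ln (real p)) + (\<Sum>p\<in>?l. L\<^sup>2 / ln (real p))"
      by (subst sum.union_disjoint[symmetric]) (auto intro!: sum.cong simp: power2_eq_square)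
    also have "(\<Sum>p\<in>?s. L\<^sup>2 / ln (real p)) \<le> (\<Sum>p\<in>?s. L\<^sup>2 / ln 2)"
      by (intro sum_mono divide_left_mono) (auto simp: prime_ge_2_nat prime_gt_1_nat dest: prime_gt_1_nat)
    also have "\<dots> = real (card ?s) * L\<^sup>2 / ln 2" by simp
    also have "\<dots> \<le> sqrt (real m) * L\<^sup>2 / ln 2"
    proof -
      have "?s \<subseteq> {1..nat \<lfloor>sqrt (real m)\<rfloor>}"
      proof
        fix p assume p: "p \<in> ?s"
        then have "real p \<le> sqrt (real m)"
          by (intro real_le_rsqrt) (metis (mono_tags, lifting) mem_Collect_eq of_nat_le_iff of_nat_power)
        then show "p \<in> {1..nat \<lfloor>sqrt (real m)\<rfloor>}"
          using p by (auto simp: le_nat_floor prime_gt_0_nat Suc_le_eq)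
      qed
      then have "card ?s \<le> nat \<lfloor>sqrt (real m)\<rfloor>"
        by (metis card_atLeastAtMost card_mono diff_Suc_1 finite_atLeastAtMost)
      then have "real (card ?s) \<le> sqrt (real m)"
        by (meson of_nat_floor of_nat_mono order.trans real_sqrt_ge_zero of_nat_0_le_iff)
      then show ?thesis by (intro divide_right_mono mult_right_mono) auto
    qed
    also have "\<dots> \<le> 16 * real m / ln 2"
      unfolding L_def using True by (intro divide_right_mono sqrt_ln_square_le) auto
    also have "(\<Sum>p\<in>?l. L\<^sup>2 / ln (real p)) \<le> (\<Sum>p\<in>?l. 4 * ln (real p))"
    proof (rule sum_mono)
      fix p assume p: "p \<in> ?l"
      then have p1: "p > 1" by (auto dest: prime_gt_1_nat)
      have "L \<le> ln (real (p ^ 2))"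
        unfolding L_def using p True by (intro ln_mono of_nat_mono) auto
      then have "L \<le> 2 * ln (real p)" using p1 by (simp add: ln_realpow)
      then have "L\<^sup>2 \<le> (2 * ln (real p))\<^sup>2" using L by (intro power_mono) auto
      then show "L\<^sup>2 / ln (real p) \<le> 4 * ln (real p)"
        using p1 by (simp add: field_simps power2_eq_square)
    qed
    also have "\<dots> \<le> (\<Sum>p\<in>?Q. 4 * ln (real p))"
      by (intro sum_mono2) (auto simp: prime_gt_0_nat Suc_le_eq)
    also have "\<dots> \<le> 4 * (real m * ln 4)"
      using sum_ln_primes_le[of m] by (simp flip: sum_distrib_left)
    finally have main: "real (card (Sigma ?Q ?E)) * L \<le> (16 / ln 2 + 4 * ln 4) * real m"
      by (simp add: algebra_simps)
    \<comment> \<open>The outer factor 2 of \<open>K\<close> pays for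
      \<open>ln (m + 1) \<le> 2 * ln m\<close>, valid since \<open>m + 1 \<le> m ^ 2\<close> for
      \<open>m \<ge> 2\<close>.\<close>
    have "2 * real m \<le> real m * real m"
      using True by (intro mult_right_mono) auto
    then have "real m + 1 \<le> real m ^ 2"
      unfolding power2_eq_square using True by linarith
    then have "ln (real m + 1) \<le> ln (real m ^ 2)" using True by (intro ln_mono) auto
    then have "ln (real m + 1) \<le> 2 * L" using True by (simp add: L_def ln_realpow)
    then have "real (card (Sigma ?Q ?E)) * ln (real m + 1) \<le> real (card (Sigma ?Q ?E)) * (2 * L)"
      by (intro mult_left_mono) auto
    then show ?thesis
      unfolding eq K_def using mult_left_mono[OF main, of 2] by (simp only: mult_ac) linarith
  qed
  moreover have "K > 0" by (auto simp: K_def intro!: add_pos_pos)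
  ultimately show ?thesis by blast
qed

subsection \<open>Euler product bound with prescribed numbers of prime factors\<close>

lemma omegaT_prime_power_mult:
  assumes "prime p" "\<not> p dvd h" "a > 0" "h > 0"
  shows "omegaT (p ^ a * h) T = omegaT h T + (if p \<in> T then 1 else 0)"
proof -
  let ?X = "{q \<in> T. prime q \<and> q dvd h}"
  have "{q \<in> T. prime q \<and> q dvd p ^ a * h} = (if p \<in> T then insert p ?X else ?X)"
    using assms by (auto simp: prime_dvd_mult_iff prime_dvd_power_iff dest: primes_dvd_imp_eq)
  moreover have "finite ?X"
    using assms by (auto intro!: finite_subset[OF _ finite_atMost[of h]] dvd_imp_le)
  ultimately show ?thesis
    using assms by (auto simp: omegaT_def)
qed

lemma omegaT_1: "omegaT (Suc 0) T = 0"
  unfolding omegaT_def by (simp add: card_eq_0_iff)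

text \<open>The colour \<open>0\<close> marks the primes outside all \<open>T j\<close>. Since the constraints only
  concern \<open>j \<ge> 1\<close>, removing a prime power of colour \<open>c\<close> amounts to \<open>k(c := k c - 1)\<close> in all cases.\<close>

definition colour :: "nat \<Rightarrow> (nat \<Rightarrow> nat set) \<Rightarrow> nat \<Rightarrow> nat" where
  "colour r T p = (if \<exists>j\<in>{1..r}. p \<in> T j then SOME j. j \<in> {1..r} \<and> p \<in> T j else 0)"

definition omega_class :: "nat \<Rightarrow> nat \<Rightarrow> (nat \<Rightarrow> nat set) \<Rightarrow> (nat \<Rightarrow> nat) \<Rightarrow> nat set" where
  "omega_class N r T k = {n \<in> {1..N}. \<forall>j\<in>{1..r}. omegaT n (T j) = k j}"

lemma finite_omega_class [simp]: "finite (omega_class N r T k)"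
  by (simp add: omega_class_def)

lemma colour_le: "colour r T p \<le> r"
proof (cases "\<exists>j\<in>{1..r}. p \<in> T j")
  case True
  then have "\<exists>j. j \<in> {1..r} \<and> p \<in> T j" by blast
  from someI_ex[OF this] True show ?thesis by (simp add: colour_def)
qed (simp add: colour_def)

lemma colour_eq_iff:
  assumes "\<forall>i\<in>{1..r}. \<forall>j\<in>{1..r}. i \<noteq> j \<longrightarrow> T i \<inter> T j = {}" and "j \<in> {1..r}"
  shows "colour r T p = j \<longleftrightarrow> p \<in> T j"
proof (cases "\<exists>j\<in>{1..r}. p \<in> T j")
  case True
  then have "\<exists>j. j \<in> {1..r} \<and> p \<in> T j" by blast
  from someI_ex[OF this] have "colour r T p \<in> {1..r}" "p \<in> T (colour r T p)"
    using True by (auto simp: colour_def)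
  with assms show ?thesis by blast
qed (use assms in \<open>auto simp: colour_def\<close>)

lemma colour_eq_0_iff: "colour r T p = 0 \<longleftrightarrow> p \<notin> (\<Union>j\<in>{1..r}. T j)"
proof (cases "\<exists>j\<in>{1..r}. p \<in> T j")
  case True
  then have "\<exists>j. j \<in> {1..r} \<and> p \<in> T j" by blast
  from someI_ex[OF this] have "colour r T p \<in> {1..r}"
    using True by (auto simp: colour_def)
  with True show ?thesis by auto
qed (auto simp: colour_def)

text \<open>As \<open>h\<close> is free of \<open>p\<close>, only the count for the colour of
  \<open>p\<close> changes, and by exactly one. The second conclusion ensures that the subtraction
  \<open>k c - 1\<close> is not truncated for a genuine colour; for \<open>c = 0\<close> the class
  ignores \<open>k 0\<close>.\<close>

lemma omega_class_remove_prime_power: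
  assumes disj: "\<forall>i\<in>{1..r}. \<forall>j\<in>{1..r}. i \<noteq> j \<longrightarrow> T i \<inter> T j = {}"
    and n: "p ^ a * h \<in> omega_class N r T k" and p: "prime p" "\<not> p dvd h" "a > 0"
  defines "c \<equiv> colour r T p"
  shows "h \<in> omega_class N r T (k(c := k c - 1))" "c = 0 \<or> k c > 0"
proof -
  have N: "1 \<le> p ^ a * h" "p ^ a * h \<le> N" and w: "\<And>j. j \<in> {1..r} \<Longrightarrow> omegaT (p ^ a * h) (T j) = k j"
    using n by (auto simp: omega_class_def)
  have h: "h > 0" using N by (auto intro: Nat.gr0I)
  have "1 * h \<le> p ^ a * h"
    using p by (intro mult_right_mono) (auto simp: prime_gt_0_nat Suc_le_eq)
  with N have "h \<le> N" by linarith
  then have hN: "h \<in> {1..N}" using h by simp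
  have w': "k j = omegaT h (T j) + (if c = j then 1 else 0)" if "j \<in> {1..r}" for j
    using w[OF that] omegaT_prime_power_mult[OF p h, of "T j"] colour_eq_iff[OF disj that, of p]
    by (simp add: c_def)
  then show "h \<in> omega_class N r T (k(c := k c - 1))"
    using hN by (auto simp: omega_class_def)
  show "c = 0 \<or> k c > 0"
    using w'[of c] colour_le[of r T p] by (cases "c = 0") (auto simp: c_def)
qed

lemma ex_prime_power_decomp:
  assumes "prime p" "p dvd n" "n > (0::nat)"
  obtains h where "n = p ^ multiplicity p n * h" "\<not> p dvd h" "multiplicity p n > 0"
proof -
  have "\<not> is_unit p" using assms not_prime_unit by blast
  then obtain h where "n = p ^ multiplicity p n * h" "\<not> p dvd h"
    using multiplicity_decompose'[of n p] assms by (metis neq0_conv)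
  moreover have "multiplicity p n > 0"
    using assms by (simp add: prime_multiplicity_gt_zero_iff)
  ultimately show ?thesis using that by blast
qed

text \<open>These are the first two terms of the binomial expansion; they describe how
  \<open>H' (T c) ^ m c\<close> grows when one prime joins.\<close>

lemma power_add_ge_linear:
  fixes s t :: real
  assumes "s \<ge> 0" "t \<ge> 0"
  shows "s ^ Suc n + real (Suc n) * t * s ^ n \<le> (s + t) ^ Suc n"
proof (induction n)
  case (Suc n)
  have "s ^ Suc (Suc n) + real (Suc (Suc n)) * t * s ^ Suc n
      \<le> (s + t) * (s ^ Suc n + real (Suc n) * t * s ^ n)"
    using assms by (simp add: algebra_simps)
  also have "\<dots> \<le> (s + t) * (s + t) ^ Suc n"
    using assms Suc by (intro mult_left_mono) auto
  finally show ?case by simp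
qed simp

text \<open>A truncated geometric series. Summing over all exponents of a prime is the source of the
  weights \<open>1 / (p - 1)\<close> in \<open>H'\<close>.\<close>

lemma sum_inverse_powers_le:
  assumes "p > (1::real)"
  shows "(\<Sum>a=1..n. 1 / p ^ a) \<le> 1 / (p - 1)"
proof -
  have "(p - 1) * (\<Sum>a=1..n. 1 / p ^ a) = 1 - 1 / p ^ n"
    using assms by (induction n) (auto simp: field_simps)
  also have "\<dots> \<le> 1" using assms by simp
  finally show ?thesis using assms by (simp add: field_simps)
qed

lemma H'_nonneg: "(\<And>p. p \<in> A \<Longrightarrow> prime p) \<Longrightarrow> H' A \<ge> 0"
  unfolding H'_def by (intro sum_nonneg) (auto dest!: prime_gt_0_nat simp: Suc_le_eq)

lemma H'_insert: "finite A \<Longrightarrow> p \<notin> A \<Longrightarrow> H' (insert p A) = H' A + 1 / (real p - 1)"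
  by (simp add: H'_def)

text \<open>An upper bound for the sum of \<open>1 / h\<close> over class members composed of primes
  in \<open>Q\<close>. Choosing \<open>m j\<close> primes of colour \<open>j\<close> gives an
  elementary symmetric sum, at most a power over a factorial; the unconstrained colour
  \<open>0\<close> gives a product of factors \<open>1 + 1 / (p - 1)\<close>, at most an
  exponential.\<close>

definition smooth_bound :: "nat \<Rightarrow> (nat \<Rightarrow> nat set) \<Rightarrow> nat set \<Rightarrow> (nat \<Rightarrow> nat) \<Rightarrow> real" where
  "smooth_bound r T Q m =
     (\<Prod>j=1..r. H' (T j \<inter> Q) ^ m j / fact (m j)) * exp (H' {p\<in>Q. colour r T p = 0})"

text \<open>The two summands stand for the integers prime to \<open>p\<close> and those divisible by
  \<open>p\<close>. With \<open>t = 1 / (p - 1)\<close>, colour \<open>0\<close> needs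
  \<open>1 + t \<le> exp t\<close>, and any other colour needs
  \<open>power_add_ge_linear\<close>.\<close>

lemma smooth_bound_insert:
  assumes disj: "\<forall>i\<in>{1..r}. \<forall>j\<in>{1..r}. i \<noteq> j \<longrightarrow> T i \<inter> T j = {}"
    and Q: "finite Q" "\<And>q. q \<in> Q \<Longrightarrow> prime q" and p: "prime p" "p \<notin> Q"
  defines "c \<equiv> colour r T p"
  shows "smooth_bound r T Q m + (if c = 0 \<or> m c > 0 then smooth_bound r T Q (m(c := m c - 1)) / (real p - 1) else 0)
           \<le> smooth_bound r T (insert p Q) m"
proof (cases "c = 0")
  case True
  have "p \<notin> T j" if "j \<in> {1..r}" for j
    using True that colour_eq_0_iff[of r T p] by (auto simp: c_def)
  then have T: "(\<Prod>j=1..r. H' (T j \<inter> insert p Q) ^ m j / fact (m j)) = (\<Prod>j=1..r. H' (T j \<inter> Q) ^ m j / fact (m j))"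
    by (intro prod.cong) auto
  have m: "smooth_bound r T Q (m(c := m c - 1)) = smooth_bound r T Q m"
    using True unfolding smooth_bound_def by (intro arg_cong2[where f = "(*)"] prod.cong refl) auto
  have "{q \<in> insert p Q. colour r T q = 0} = insert p {q\<in>Q. colour r T q = 0}"
    using True by (auto simp: c_def)
  then have "H' {q \<in> insert p Q. colour r T q = 0} = H' {q\<in>Q. colour r T q = 0} + 1 / (real p - 1)"
    using Q p by (simp add: H'_insert)
  then have "smooth_bound r T (insert p Q) m = smooth_bound r T Q m * exp (1 / (real p - 1))"
    unfolding smooth_bound_def T by (simp only: exp_add mult.assoc)
  also have "\<dots> \<ge> smooth_bound r T Q m * (1 + 1 / (real p - 1))"
    using Q unfolding smooth_bound_def
    by (intro mult_left_mono exp_ge_add_one_self mult_nonneg_nonneg prod_nonneg) (auto intro!: divide_nonneg_nonneg H'_nonneg zero_le_power)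
  finally show ?thesis using True m by (simp add: algebra_simps)
next
  case False
  then have c: "c \<in> {1..r}" using colour_le[of r T p] by (auto simp: c_def)
  define s t where "s = H' (T c \<inter> Q)" and "t = 1 / (real p - 1)"
  \<comment> \<open>\<open>R\<close> gathers all factors unaffected by adding \<open>p\<close>,
    leaving an inequality in the coordinate \<open>c\<close> alone.\<close>
  define R where "R = (\<Prod>j\<in>{1..r}-{c}. H' (T j \<inter> Q) ^ m j / fact (m j)) * exp (H' {p\<in>Q. colour r T p = 0})"
  have s: "s \<ge> 0" and t: "t \<ge> 0"
    using Q p by (auto simp: s_def t_def prime_gt_0_nat Suc_le_eq intro!: H'_nonneg)
  have R: "R \<ge> 0"
    unfolding R_def using Q by (intro mult_nonneg_nonneg prod_nonneg) (auto intro!: divide_nonneg_nonneg H'_nonneg zero_le_power)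
  have pT: "p \<in> T j \<longleftrightarrow> j = c" if "j \<in> {1..r}" for j
    using colour_eq_iff[OF disj that, of p] by (auto simp: c_def)
  have 1: "smooth_bound r T Q m' = s ^ m' c / fact (m' c) * R" if "\<And>j. j \<noteq> c \<Longrightarrow> m' j = m j" for m'
    unfolding smooth_bound_def R_def s_def using c that
    by (subst prod.remove[of _ c]) (auto intro!: prod.cong)
  have "{q \<in> insert p Q. colour r T q = 0} = {q\<in>Q. colour r T q = 0}"
    using False by (auto simp: c_def)
  moreover have "H' (T c \<inter> insert p Q) = s + t"
    using pT[OF c] Q p by (simp add: H'_insert s_def t_def)
  moreover have "(\<Prod>j\<in>{1..r}-{c}. H' (T j \<inter> insert p Q) ^ m j / fact (m j)) = (\<Prod>j\<in>{1..r}-{c}. H' (T j \<inter> Q) ^ m j / fact (m j))"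
    using pT by (intro prod.cong) auto
  ultimately have 2: "smooth_bound r T (insert p Q) m = (s + t) ^ m c / fact (m c) * R"
    unfolding smooth_bound_def R_def using c by (subst prod.remove[of _ c]) auto
  show ?thesis
  proof (cases "m c")
    case 0
    then show ?thesis using False by (simp add: 1 2)
  next
    case (Suc l)
    have "s ^ Suc l / fact (Suc l) + t * s ^ l / fact l = (s ^ Suc l + real (Suc l) * t * s ^ l) / fact (Suc l)"
      by (simp add: add_divide_distrib del: of_nat_Suc)
    also have "\<dots> \<le> (s + t) ^ Suc l / fact (Suc l)"
      using power_add_ge_linear[OF s t] by (intro divide_right_mono) auto
    finally have "(s ^ Suc l / fact (Suc l) + t * s ^ l / fact l) * R \<le> (s + t) ^ Suc l / fact (Suc l) * R"
      using R by (intro mult_right_mono)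
    moreover have "smooth_bound r T Q (m(c := m c - 1)) / (real p - 1) = t * s ^ l / fact l * R"
      by (subst 1) (auto simp: Suc t_def)
    moreover have "smooth_bound r T Q m = s ^ Suc l / fact (Suc l) * R"
      by (subst 1) (auto simp: Suc)
    ultimately show ?thesis using False by (simp only: 2 Suc distrib_right) auto
  qed
qed

text \<open>Induction on the set of admissible primes; \<open>m\<close> must vary, since stripping
  off the power of the new prime lowers one of its entries.\<close>

lemma sum_inverse_smooth_le:
  assumes disj: "\<forall>i\<in>{1..r}. \<forall>j\<in>{1..r}. i \<noteq> j \<longrightarrow> T i \<inter> T j = {}"
    and "finite Q" "\<And>q. q \<in> Q \<Longrightarrow> prime q"
  shows "(\<Sum>h | h \<in> omega_class N r T m \<and> (\<forall>q. prime q \<and> q dvd h \<longrightarrow> q \<in> Q). 1 / real h) \<le> smooth_bound r T Q m"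
  using assms(2,3)
proof (induction Q arbitrary: m rule: finite_induct)
  case empty
  let ?S = "{h \<in> omega_class N r T m. \<forall>q. prime q \<and> q dvd h \<longrightarrow> q \<in> {}}"
  \<comment> \<open>Without admissible primes only \<open>h = 1\<close> can remain, and it lies in
    the class only when all prescribed counts vanish, in which case the bound is
    \<open>1\<close>.\<close>
  have sub: "?S \<subseteq> {1}"
    using prime_factor_nat by auto
  have "smooth_bound r T {} m \<ge> 0"
    by (auto simp: smooth_bound_def H'_def intro!: prod_nonneg)
  show ?case
  proof (cases "1 \<in> ?S")
    case True
    then have "\<forall>j\<in>{1..r}. m j = 0"
      by (auto simp: omega_class_def omegaT_1)
    then have "smooth_bound r T {} m = 1"
      by (simp add: smooth_bound_def H'_def)
    moreover have "?S = {1}" using sub True by blast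
    ultimately show ?thesis by simp
  next
    case False
    then have "?S = {}" using sub by blast
    then show ?thesis using \<open>smooth_bound r T {} m \<ge> 0\<close> by (simp only: sum.empty)
  qed
next
  case (insert p Q)
  have p: "prime p" using insert by auto
  define c where "c = colour r T p"
  let ?S = "\<lambda>Q m. {h. h \<in> omega_class N r T m \<and> (\<forall>q. prime q \<and> q dvd h \<longrightarrow> q \<in> Q)}"
  let ?D = "{h \<in> ?S (insert p Q) m. p dvd h}"
  have fin: "finite (?S Q m)" for Q m
    by (rule finite_subset[OF _ finite_omega_class]) auto
  have split: "?S (insert p Q) m = ?S Q m \<union> ?D"
    using insert by auto
  have decomp: "\<exists>a h. n = p ^ a * h \<and> a \<in> {1..N} \<and> h \<in> ?S Q (m(c := m c - 1)) \<and> (c = 0 \<or> m c > 0)" if n: "n \<in> ?D" for n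
  proof -
    have n': "n > 0" "n \<le> N" "p dvd n" using n by (auto simp: omega_class_def)
    obtain h where h: "n = p ^ multiplicity p n * h" "\<not> p dvd h" "multiplicity p n > 0"
      using ex_prime_power_decomp[OF p n'(3,1)] .
    let ?a = "multiplicity p n"
    have "?a < p ^ ?a"
      using prime_ge_2_nat[OF p] by (intro less_exp[THEN order.strict_trans2] power_mono) auto
    also have "\<dots> \<le> n" using n' by (intro dvd_imp_le multiplicity_dvd)
    finally have "?a \<in> {1..N}" using h n' by simp
    moreover have "p ^ ?a * h \<in> omega_class N r T m" using n h(1) by simp
    note omega_class_remove_prime_power[OF disj this p h(2,3)]
    moreover have "\<forall>q. prime q \<and> q dvd h \<longrightarrow> q \<in> Q"
      using n h(1,2) by (metis (mono_tags, lifting) dvd_mult insertE mem_Collect_eq)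
    ultimately show ?thesis using h(1) unfolding c_def by blast
  qed
  have D: "(\<Sum>h\<in>?D. 1 / real h) \<le> (if c = 0 \<or> m c > 0 then smooth_bound r T Q (m(c := m c - 1)) / (real p - 1) else 0)"
  proof (cases "c = 0 \<or> m c > 0")
    case False
    have "n \<notin> ?D" for n using decomp[of n] False by blast
    then have "?D = {}" by (simp only: set_eq_iff empty_iff) simp
    then show ?thesis using False by (simp only: sum.empty) simp
  next
    case True
    \<comment> \<open>It suffices that every \<open>n\<close> in \<open>?D\<close> comes from some
      pair \<open>(a, h)\<close>; pairs with \<open>p ^ a * h > N\<close> merely add nonnegative
      terms.\<close>
    have "(\<Sum>h\<in>?D. 1 / real h) \<le> (\<Sum>(a, h)\<in>{1..N} \<times> ?S Q (m(c := m c - 1)). 1 / real p ^ a * (1 / real h))"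
    proof (rule sum_le_included[where i = "\<lambda>(a, h). p ^ a * h"])
      show "finite ?D" by (rule finite_subset[OF _ fin[of m "insert p Q"]]) auto
      show "finite ({1..N} \<times> ?S Q (m(c := m c - 1)))" using fin by simp
      show "\<forall>n\<in>?D. \<exists>y\<in>{1..N} \<times> ?S Q (m(c := m c - 1)). (case y of (a, h) \<Rightarrow> p ^ a * h) = n \<and>
              1 / real n \<le> (case y of (a, h) \<Rightarrow> 1 / real p ^ a * (1 / real h))"
      proof
        fix n assume "n \<in> ?D"
        from decomp[OF this] obtain a h where "n = p ^ a * h" "a \<in> {1..N}" "h \<in> ?S Q (m(c := m c - 1))"
          by blast
        then show "\<exists>y\<in>{1..N} \<times> ?S Q (m(c := m c - 1)). (case y of (a, h) \<Rightarrow> p ^ a * h) = n \<and>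
              1 / real n \<le> (case y of (a, h) \<Rightarrow> 1 / real p ^ a * (1 / real h))"
          by (intro bexI[of _ "(a, h)"]) auto
      qed
    qed auto
    also have "\<dots> = (\<Sum>a=1..N. 1 / real p ^ a) * (\<Sum>h\<in>?S Q (m(c := m c - 1)). 1 / real h)"
      by (simp only: sum_product sum.cartesian_product)
    also have "\<dots> \<le> 1 / (real p - 1) * smooth_bound r T Q (m(c := m c - 1))"
      using insert p prime_gt_1_nat[OF p]
      by (intro mult_mono sum_inverse_powers_le insert.IH) (auto intro!: sum_nonneg)
    finally show ?thesis using True by simp
  qed
  have "(\<Sum>h\<in>?S (insert p Q) m. 1 / real h) = (\<Sum>h\<in>?S Q m. 1 / real h) + (\<Sum>h\<in>?D. 1 / real h)"
  proof (subst split, rule sum.union_disjoint[OF fin])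
    show "finite ?D" by (rule finite_subset[OF _ fin[of m "insert p Q"]]) auto
    show "?S Q m \<inter> ?D = {}" using insert.hyps p by blast
  qed
  also have "\<dots> \<le> smooth_bound r T Q m + (if c = 0 \<or> m c > 0 then smooth_bound r T Q (m(c := m c - 1)) / (real p - 1) else 0)"
    using insert by (intro add_mono D insert.IH) auto
  also have "\<dots> \<le> smooth_bound r T (insert p Q) m"
    unfolding c_def using insert p by (intro smooth_bound_insert disj) auto
  finally show ?case .
qed

text \<open>With \<open>Q\<close> the set of all primes up to \<open>N\<close>, the condition on
  prime divisors is vacuous on the class.\<close>

lemma sum_inverse_omega_class_le:
  assumes disj: "\<forall>i\<in>{1..r}. \<forall>j\<in>{1..r}. i \<noteq> j \<longrightarrow> T i \<inter> T j = {}"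
    and T: "\<forall>j\<in>{1..r}. T j \<subseteq> {p. prime p \<and> p \<le> N}"
  shows "(\<Sum>h\<in>omega_class N r T m. 1 / real h) \<le>
           (\<Prod>j=1..r. H' (T j) ^ m j / fact (m j)) * exp (H' ({p. prime p \<and> p \<le> N} - (\<Union>j\<in>{1..r}. T j)))"
proof -
  let ?Q = "{p. prime p \<and> p \<le> N}"
  have "omega_class N r T m = {h. h \<in> omega_class N r T m \<and> (\<forall>q. prime q \<and> q dvd h \<longrightarrow> q \<in> ?Q)}"
    by (auto simp: omega_class_def dest!: dvd_imp_le)
  then have "(\<Sum>h\<in>omega_class N r T m. 1 / real h) =
      (\<Sum>h | h \<in> omega_class N r T m \<and> (\<forall>q. prime q \<and> q dvd h \<longrightarrow> q \<in> ?Q). 1 / real h)"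
    by (rule arg_cong)
  also have "\<dots> \<le> smooth_bound r T ?Q m"
    by (rule sum_inverse_smooth_le[OF disj]) auto
  also have "{p\<in>?Q. colour r T p = 0} = ?Q - (\<Union>j\<in>{1..r}. T j)"
    by (auto simp: colour_eq_0_iff)
  then have "smooth_bound r T ?Q m =
      (\<Prod>j=1..r. H' (T j) ^ m j / fact (m j)) * exp (H' (?Q - (\<Union>j\<in>{1..r}. T j)))"
    unfolding smooth_bound_def using T by (auto intro!: prod.cong simp: Int_absorb2)
  finally show ?thesis .
qed

subsection \<open>Removing one prime power\<close>

text \<open>With \<open>h = n / p\<^sup>a\<close>, the summand below is \<open>ln (N / h)\<close>; it absorbs both \<open>ln (N / n)\<close> and the
  share of \<open>p\<close> in \<open>ln n\<close>.\<close>

lemma ln_le_sum_prime_divisors: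
  assumes "2 \<le> n" "n \<le> N"
  shows "ln (real N) \<le> (\<Sum>p | prime p \<and> p dvd n. ln (real N) - ln (real n) + real (multiplicity p n) * ln (real p))"
proof -
  let ?D = "{p. prime p \<and> p dvd n}"
  have D: "?D = prime_factors n" "finite ?D"
    using assms by (auto simp: in_prime_factors_iff)
  have "real n = (\<Prod>p\<in>?D. real p ^ multiplicity p n)"
    using prime_factorization_nat[of n] assms unfolding D(1)
    by (metis (mono_tags, lifting) of_nat_power of_nat_prod gr0I not_numeral_le_zero prod.cong)
  also have "ln \<dots> = (\<Sum>p\<in>?D. ln (real p ^ multiplicity p n))"
    using D(2) by (intro ln_prod) (auto simp: prime_gt_0_nat)
  also have "\<dots> = (\<Sum>p\<in>?D. real (multiplicity p n) * ln (real p))"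
    by (intro sum.cong) (auto simp: ln_realpow prime_gt_0_nat)
  finally have 1: "(\<Sum>p\<in>?D. ln (real N) - ln (real n) + real (multiplicity p n) * ln (real p))
      = real (card ?D) * (ln (real N) - ln (real n)) + ln (real n)"
    by (simp add: sum.distrib)
  have "\<exists>p. prime p \<and> p dvd n"
    using assms by (intro prime_factor_nat) auto
  then have "card ?D \<ge> 1"
    using D(2) by (auto simp: Suc_le_eq card_gt_0_iff)
  then have "1 * (ln (real N) - ln (real n)) \<le> real (card ?D) * (ln (real N) - ln (real n))"
    using assms by (intro mult_right_mono) auto
  then show ?thesis unfolding 1 by simp
qed

text \<open>Each \<open>n > 1\<close> is charged \<open>ln N\<close>, which is distributed over its
  prime divisors; regrouping by cofactor \<open>h\<close> leaves a count of prime powers up to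
  \<open>N div h\<close>. \<open>J\<close> holds the colours a removed prime can have, with
  \<open>0\<close> present only if some prime up to \<open>N\<close> is uncoloured. The integer
  \<open>1\<close> is excluded because it has no prime divisor.\<close>

lemma card_omega_class_ln_le:
  fixes k :: "nat \<Rightarrow> nat" and N :: nat
  assumes disj: "\<forall>i\<in>{1..r}. \<forall>j\<in>{1..r}. i \<noteq> j \<longrightarrow> T i \<inter> T j = {}"
    and K: "\<And>m. real (card {(p, a). prime p \<and> a > 0 \<and> p ^ a \<le> m}) * ln (real m + 1) \<le> K * real m" "K > 0"
  defines "J \<equiv> {j\<in>{1..r}. k j > 0} \<union> (if {p. prime p \<and> p \<le> N} \<subseteq> (\<Union>j\<in>{1..r}. T j) then {} else {0})"
  shows "real (card (omega_class N r T k - {1})) * ln (real N)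
           \<le> K * real N * (\<Sum>c\<in>J. \<Sum>h\<in>omega_class N r T (k(c := k c - 1)). 1 / real h)"
proof -
  let ?A = "omega_class N r T k - {1}"
  let ?S = "\<lambda>c. omega_class N r T (k(c := k c - 1))"
  let ?PP = "\<lambda>m. {(p, a). prime p \<and> a > 0 \<and> p ^ a \<le> m}"
  let ?t = "SIGMA c:J. SIGMA h:?S c. ?PP (N div h)"
  let ?s = "SIGMA n:?A. {p. prime p \<and> p dvd n}"
  define f where "f = (\<lambda>(n, p). ln (real N) - ln (real n) + real (multiplicity p n) * ln (real p))"
  define g where "g = (\<lambda>(c::nat, h, q::nat \<times> nat). ln (real N / real h))"
  have finJ: "finite J" by (auto simp: J_def)
  have A: "2 \<le> n" "n \<le> N" if "n \<in> ?A" for n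
    using that by (auto simp: omega_class_def)
  have finD: "finite {p. prime p \<and> p dvd n}" if "n \<in> ?A" for n
    using A[OF that] by (intro finite_subset[OF _ finite_primes_le[of n]]) (auto dest: dvd_imp_le)
  have "real (card ?A) * ln (real N) = (\<Sum>n\<in>?A. ln (real N))"
    by simp
  also have "\<dots> \<le> (\<Sum>n\<in>?A. \<Sum>p | prime p \<and> p dvd n. f (n, p))"
    unfolding f_def prod.case by (intro sum_mono ln_le_sum_prime_divisors A)
  also have "\<dots> = (\<Sum>x\<in>?s. f x)"
    using finD by (subst sum.Sigma) auto
  also have "\<dots> \<le> (\<Sum>x\<in>?t. g x)"
  \<comment> \<open>Each \<open>(n, p)\<close> is hit by the triple of colour, cofactor and exact
    prime power; there \<open>f\<close> and \<open>g\<close> agree, both being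
    \<open>ln (N / h)\<close>.\<close>
  proof (rule sum_le_included[where i = "\<lambda>(c, h, (p, a)). (p ^ a * h, p)"])
    show "finite ?s" using finD by (intro finite_SigmaI) auto
    show "finite ?t" using finJ finite_prime_powers_le by (intro finite_SigmaI) auto
    show "\<forall>y\<in>?t. 0 \<le> g y" by (auto simp: g_def omega_class_def)
    show "\<forall>x\<in>?s. \<exists>y\<in>?t. (case y of (c, h, (p, a)) \<Rightarrow> (p ^ a * h, p)) = x \<and> f x \<le> g y"
    proof
      fix x assume "x \<in> ?s"
      then obtain n p where x: "x = (n, p)" and n: "n \<in> ?A" and p: "prime p" "p dvd n" by blast
      define a c where "a = multiplicity p n" and "c = colour r T p"
      have n0: "n > 0" using A[OF n] by simp
      obtain h where h: "n = p ^ a * h" "\<not> p dvd h" "a > 0"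
        using ex_prime_power_decomp[OF p n0] unfolding a_def .
      have "p ^ a * h \<in> omega_class N r T k" using n h by auto
      note rem = omega_class_remove_prime_power[OF disj this p(1) h(2,3), folded c_def]
      have h0: "h > 0" using h n0 by (auto intro: Nat.gr0I)
      have "p \<le> N" using A[OF n] dvd_imp_le[OF p(2) n0] by simp
      have "c \<in> J"
      proof (cases "c = 0")
        case True
        then have "p \<notin> (\<Union>j\<in>{1..r}. T j)" by (simp only: c_def colour_eq_0_iff) simp
        then show ?thesis using True \<open>p \<le> N\<close> p by (auto simp: J_def)
      next
        case False
        then show ?thesis using rem(2) colour_le[of r T p] by (auto simp: J_def c_def)
      qed
      moreover have "p ^ a \<le> N div h"
        using A[OF n] h0 h(1) by (simp add: less_eq_div_iff_mult_less_eq)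
      ultimately have "(c, h, (p, a)) \<in> ?t"
        using rem(1) p h by auto
      moreover have "f x = g (c, h, (p, a))"
      proof -
        have "ln (real n) = real a * ln (real p) + ln (real h)"
          using h0 p prime_gt_0_nat[OF p(1)] by (simp add: h(1) ln_mult ln_realpow)
        moreover have "ln (real N / real h) = ln (real N) - ln (real h)"
          using h0 A[OF n] by (simp add: ln_div)
        ultimately show ?thesis by (simp add: f_def g_def x a_def)
      qed
      ultimately show "\<exists>y\<in>?t. (case y of (c, h, (p, a)) \<Rightarrow> (p ^ a * h, p)) = x \<and> f x \<le> g y"
        using x h(1) by (intro bexI[of _ "(c, h, (p, a))"]) auto
    qed
  qed
  also have "\<dots> = (\<Sum>c\<in>J. \<Sum>h\<in>?S c. real (card (?PP (N div h))) * ln (real N / real h))"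
  proof -
    have "(\<Sum>x\<in>?t. g x) = (\<Sum>c\<in>J. \<Sum>y\<in>(SIGMA h:?S c. ?PP (N div h)). g (c, y))"
      using finJ finite_prime_powers_le by (subst sum.Sigma) auto
    also have "\<dots> = (\<Sum>c\<in>J. \<Sum>h\<in>?S c. \<Sum>q\<in>?PP (N div h). g (c, h, q))"
      using finite_prime_powers_le by (subst sum.Sigma) auto
    finally show ?thesis by (simp add: g_def)
  qed
  also have "\<dots> \<le> (\<Sum>c\<in>J. \<Sum>h\<in>?S c. K * (real N * (1 / real h)))"
  proof (intro sum_mono)
    fix c h assume "h \<in> ?S c"
    then have h: "h > 0" "h \<le> N" by (auto simp: omega_class_def)
    \<comment> \<open>This puts the logarithm into the shifted form of hypothesis \<open>K\<close>
      at \<open>m = N div h\<close>, cancelling it against the count.\<close>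
    have "real N / real h \<le> real (N div h) + 1"
      using floor_divide_of_nat_eq[of N h, where ?'a = real] by linarith
    then have "real (card (?PP (N div h))) * ln (real N / real h) \<le> real (card (?PP (N div h))) * ln (real (N div h) + 1)"
      using h by (intro mult_left_mono ln_mono) auto
    also have "\<dots> \<le> K * real (N div h)" by (rule K)
    also have "\<dots> \<le> K * (real N * (1 / real h))"
      using K(2) floor_divide_of_nat_eq[of N h, where ?'a = real]
      by (intro mult_left_mono) (simp, linarith, simp)
    finally show "real (card (?PP (N div h))) * ln (real N / real h) \<le> K * (real N * (1 / real h))" .
  qed
  also have "\<dots> = K * real N * (\<Sum>c\<in>J. \<Sum>h\<in>?S c. 1 / real h)"
    by (simp add: sum_distrib_left mult.assoc)
  finally show ?thesis .
qed

section \<open>Elementary comparisons for \<open>H\<close> and \<open>H'\<close>, and a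
  Bernoulli-type product inequality\<close>

lemma H_primes_le_ln: "n > 0 \<Longrightarrow> H {p. prime p \<and> p \<le> n} \<le> ln (real n)"
proof -
  assume n: "n > 0"
  have "H {p. prime p \<and> p \<le> n} \<le> (\<Sum>i=2..n. 1 / real i)"
    unfolding H_def by (intro sum_mono2) (auto dest: prime_ge_2_nat)
  also have "\<dots> \<le> ln (real n)"
    using n
  proof (induction n rule: nat_induct_non_zero)
    case (Suc n)
    have "ln (real n / real (Suc n)) \<le> real n / real (Suc n) - 1"
      using Suc by (intro ln_le_minus_one) auto
    then have "1 / real (Suc n) \<le> ln (real (Suc n)) - ln (real n)"
      using Suc by (simp add: ln_div field_simps)
    then show ?case using Suc by simp
  qed simp
  finally show ?thesis .
qed

text \<open>The differences \<open>1 / (p - 1) - 1 / p\<close>, extended to all integers from 2 on,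
  telescope to less than 1.\<close>

lemma H'_le_H:
  assumes "finite A" "\<And>p. p \<in> A \<Longrightarrow> prime p"
  shows "H' A \<le> H A + 1"
proof -
  \<comment> \<open>Inserting \<open>1\<close> makes \<open>Max\<close> meaningful for empty
    \<open>A\<close> and ensures \<open>n \<ge> 1\<close>.\<close>
  define n where "n = Max (insert 1 A)"
  have n: "n \<ge> 1" "\<And>p. p \<in> A \<Longrightarrow> p \<le> n" using assms by (auto simp: n_def)
  have "H' A - H A = (\<Sum>p\<in>A. 1 / (real p - 1) - 1 / real p)"
    by (simp add: H'_def H_def sum_subtractf)
  also have "\<dots> \<le> (\<Sum>i=2..n. 1 / (real i - 1) - 1 / real i)"
  proof (rule sum_mono2)
    show "A \<subseteq> {2..n}" using n assms prime_ge_2_nat by auto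
  qed (auto simp: field_simps)
  also have "\<dots> = 1 - 1 / real n"
    using n(1) by (induction n rule: dec_induct) auto
  also have "\<dots> \<le> 1" by simp
  finally show ?thesis by simp
qed

text \<open>Bernoulli's inequality handles each factor, and
  \<open>1 + a + S \<le> (1 + a) * (1 + S)\<close> lets the factors be multiplied. This absorbs the
  sum of the \<open>k j / H' (T j)\<close> into larger bases.\<close>

lemma prod_power_ge_linear:
  fixes s :: "'a \<Rightarrow> real"
  assumes "finite I" "\<And>j. j \<in> I \<Longrightarrow> s j > 0"
  shows "(\<Prod>j\<in>I. s j ^ k j) * (1 + (\<Sum>j\<in>I. real (k j) / s j)) \<le> (\<Prod>j\<in>I. (s j + 1) ^ k j)"
  using assms
proof (induction I rule: finite_induct)
  case (insert i I)
  define P S where "P = (\<Prod>j\<in>I. s j ^ k j)" and "S = (\<Sum>j\<in>I. real (k j) / s j)"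
  have P: "P \<ge> 0" and S: "S \<ge> 0" and si: "s i > 0"
    using insert by (auto simp: P_def S_def less_imp_le intro!: prod_nonneg sum_nonneg)
  have "1 + real (k i) / s i \<le> (1 + 1 / s i) ^ k i"
    using Bernoulli_inequality[of "1 / s i" "k i"] si by (simp add: order.trans[of "-1" 0])
  then have "s i ^ k i * (1 + real (k i) / s i) \<le> s i ^ k i * (1 + 1 / s i) ^ k i"
    using si by (intro mult_left_mono) auto
  also have "\<dots> = (s i + 1) ^ k i"
    using si by (simp add: field_simps flip: power_mult_distrib)
  finally have 1: "s i ^ k i * (1 + real (k i) / s i) \<le> (s i + 1) ^ k i" .
  have "(s i ^ k i * P) * (1 + (real (k i) / s i + S)) \<le> (s i ^ k i * P) * ((1 + real (k i) / s i) * (1 + S))"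
    using P S si by (intro mult_left_mono) (auto simp: distrib_left distrib_right)
  also have "\<dots> = (s i ^ k i * (1 + real (k i) / s i)) * (P * (1 + S))"
    by (simp add: mult_ac)
  also have "\<dots> \<le> (s i + 1) ^ k i * (\<Prod>j\<in>I. (s j + 1) ^ k j)"
    using insert.IH[OF insert.prems] P S si by (intro mult_mono 1) (auto simp: P_def S_def)
  finally show ?case using insert by (simp add: P_def S_def)
qed simp

section \<open>Combining the counting inequality, the Euler product and Mertens' estimate\<close>

theorem theorem2:
  "\<exists>C::real. \<forall>(x::real) (r::nat) (T::nat \<Rightarrow> nat set) (k::nat \<Rightarrow> nat).
     x \<ge> 2
     \<longrightarrow> (\<forall>j\<in>{1..r}. T j \<noteq> {} \<and> T j \<subseteq> {p. prime p \<and> real p \<le> x})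
     \<longrightarrow> (\<forall>i\<in>{1..r}. \<forall>j\<in>{1..r}. i \<noteq> j \<longrightarrow> T i \<inter> T j = {})
     \<longrightarrow> (let P = Px x (\<lambda>n. \<forall>j\<in>{1..r}. omegaT n (T j) = k j);
             \<eta> = (if {p. prime p \<and> real p \<le> x} \<subseteq> (\<Union>j\<in>{1..r}. T j) then 0 else 1 :: real);
             \<xi> = (if \<eta> = 0 \<and> (\<forall>j\<in>{1..r}. k j = 0) then 1 else 0 :: real)
         in P \<le> C * (\<Prod>j=1..r. H' (T j) ^ k j / fact (k j) * exp (- H (T j)))
                  * (\<eta> + (\<Sum>j=1..r. real (k j) / H' (T j))) + C * \<xi>
          \<and> P \<le> C * (\<Prod>j=1..r. (H (T j) + 2) ^ k j / fact (k j) * exp (- H (T j))))"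
proof -
  obtain K where K: "K > 0"
    "\<And>m. real (card {(p, a). prime p \<and> a > 0 \<and> p ^ a \<le> m}) * ln (real m + 1) \<le> K * real m"
    using card_prime_powers_le by blast
  obtain M where M: "\<And>n. n \<ge> 2 \<Longrightarrow> H {p. prime p \<and> p \<le> n} \<le> ln (ln (real n)) + M"
    using sum_inverse_primes_le by blast
  \<comment> \<open>The first term serves the integers \<open>n > 1\<close>; the added
    \<open>1\<close> pays for \<open>n = 1\<close>.\<close>
  define C where "C = K * exp (M + 1) + 1"
  have C: "C \<ge> 1" using K by (simp add: C_def)
  show ?thesis
  proof (intro exI[of _ C] allI impI)
    fix x :: real and r :: nat and T :: "nat \<Rightarrow> nat set" and k :: "nat \<Rightarrow> nat"
    assume x: "x \<ge> 2" and T': "\<forall>j\<in>{1..r}. T j \<noteq> {} \<and> T j \<subseteq> {p. prime p \<and> real p \<le> x}"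
      and disj: "\<forall>i\<in>{1..r}. \<forall>j\<in>{1..r}. i \<noteq> j \<longrightarrow> T i \<inter> T j = {}"
    define N where "N = nat \<lfloor>x\<rfloor>"
    have N: "N \<ge> 2" using x by (simp add: N_def le_nat_iff le_floor_iff)
    have le_x: "real p \<le> x \<longleftrightarrow> p \<le> N" for p
      using x by (simp add: N_def le_nat_iff le_floor_iff)
    define Q where "Q = {p. prime p \<and> p \<le> N}"
    define W where "W = (\<Union>j\<in>{1..r}. T j)"
    have Q_eq: "{p. prime p \<and> real p \<le> x} = Q" by (simp add: Q_def le_x)
    have finQ: "finite Q" by (simp add: Q_def)
    have TQ: "T j \<subseteq> Q" "T j \<noteq> {}" if "j \<in> {1..r}" for j
      using T' that by (auto simp: Q_eq)
    have finT: "finite (T j)" if "j \<in> {1..r}" for j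
      using TQ[OF that] finQ finite_subset by blast
    have primeT: "prime p" if "j \<in> {1..r}" "p \<in> T j" for j p
      using TQ[OF that(1)] that(2) by (auto simp: Q_def)
    have WQ: "W \<subseteq> Q" using TQ(1) unfolding W_def by blast
    have H'_pos: "H' (T j) > 0" if "j \<in> {1..r}" for j
      unfolding H'_def using finT[OF that] TQ(2)[OF that] prime_gt_1_nat[OF primeT[OF that]]
      by (intro sum_pos) auto
    have HW: "H W = (\<Sum>j=1..r. H (T j))"
      unfolding H_def W_def using disj finT by (intro sum.UNION_disjoint) auto
    have HQ: "H Q = H (Q - W) + H W"
      unfolding H_def using WQ finQ by (rule sum.subset_diff)
    define \<eta> :: real where "\<eta> = (if Q \<subseteq> W then 0 else 1)"
    define E where "E = (\<Prod>j=1..r. exp (- H (T j)))"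
    define B where "B = (\<Prod>j=1..r. H' (T j) ^ k j / fact (k j))"
    define Z where "Z = (\<Sum>j=1..r. real (k j) / H' (T j))"
    have E: "E = exp (- H W)"
      unfolding E_def HW by (simp add: exp_sum flip: sum_negf)
    have B0: "B \<ge> 0" and Z0: "Z \<ge> 0" and E0: "E \<ge> 0"
      using H'_pos by (auto simp: B_def Z_def E_def less_imp_le intro!: prod_nonneg sum_nonneg divide_nonneg_nonneg zero_le_power)
    have BE: "(\<Prod>j=1..r. H' (T j) ^ k j / fact (k j) * exp (- H (T j))) = B * E"
      unfolding B_def E_def by (rule prod.distrib)
    let ?A = "omega_class N r T k"
    define J where "J = {j\<in>{1..r}. k j > 0} \<union> (if Q \<subseteq> W then {} else {0})"

    \<comment> \<open>Mertens bounds \<open>H Q\<close>, and \<open>H (Q - W) = H Q - H W\<close>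
      brings in \<open>E\<close>. The factor \<open>ln N\<close> will cancel the one in the counting
      inequality.\<close>
    have exp_uncoloured: "exp (H' (Q - W)) \<le> exp (M + 1) * ln (real N) * E"
    proof -
      have "H' (Q - W) \<le> H (Q - W) + 1"
        using finQ by (intro H'_le_H) (auto simp: Q_def)
      also have "\<dots> \<le> (M + 1) + ln (ln (real N)) + - H W"
        using HQ M[OF N] by (simp add: Q_def)
      finally have "exp (H' (Q - W)) \<le> exp ((M + 1) + ln (ln (real N)) + - H W)" by simp
      also have "\<dots> = exp (M + 1) * ln (real N) * E"
        using N by (simp only: exp_add E) simp
      finally show ?thesis .
    qed
    \<comment> \<open>Lowering the exponent and the factorial by one trades a factor
      \<open>H' (T c)\<close> for a factor \<open>k c\<close>.\<close>
    have remove: "(\<Prod>j=1..r. H' (T j) ^ (k(c := k c - 1)) j / fact ((k(c := k c - 1)) j)) = B * (real (k c) / H' (T c))"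
      if c: "c \<in> {1..r}" "k c > 0" for c
    proof -
      obtain l where l: "k c = Suc l" using c(2) gr0_implies_Suc by blast
      have "(\<Prod>j\<in>{1..r}-{c}. H' (T j) ^ (k(c := k c - 1)) j / fact ((k(c := k c - 1)) j))
          = (\<Prod>j\<in>{1..r}-{c}. H' (T j) ^ k j / fact (k j))"
        by (intro prod.cong) auto
      then show ?thesis
        unfolding B_def using c H'_pos[OF c(1)]
        by (subst (1 2) prod.remove[of _ c]) (auto simp: l field_simps simp del: of_nat_Suc)
    qed
    have "real (card (?A - {1})) * ln (real N) \<le> K * real N * (\<Sum>c\<in>J. \<Sum>h\<in>omega_class N r T (k(c := k c - 1)). 1 / real h)"
      unfolding J_def Q_def W_def by (rule card_omega_class_ln_le[OF disj K(2,1)])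
    also have "(\<Sum>c\<in>J. \<Sum>h\<in>omega_class N r T (k(c := k c - 1)). 1 / real h)
        \<le> (\<Sum>c\<in>J. (\<Prod>j=1..r. H' (T j) ^ (k(c := k c - 1)) j / fact ((k(c := k c - 1)) j)) * exp (H' (Q - W)))"
      unfolding Q_def W_def using TQ(1) unfolding Q_def by (intro sum_mono sum_inverse_omega_class_le[OF disj]) blast
    also have "\<dots> = (\<Sum>c\<in>J. \<Prod>j=1..r. H' (T j) ^ (k(c := k c - 1)) j / fact ((k(c := k c - 1)) j)) * exp (H' (Q - W))"
      by (simp only: sum_distrib_right)
    \<comment> \<open>Genuine colours yield \<open>B * Z\<close>, those with \<open>k c = 0\<close>
      contributing nothing; colour \<open>0\<close> leaves the product unchanged and yields
      \<open>B * \<eta>\<close>.\<close>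
    also have "(\<Sum>c\<in>J. \<Prod>j=1..r. H' (T j) ^ (k(c := k c - 1)) j / fact ((k(c := k c - 1)) j)) = B * (\<eta> + Z)"
    proof -
      let ?f = "\<lambda>c. \<Prod>j=1..r. H' (T j) ^ (k(c := k c - 1)) j / fact ((k(c := k c - 1)) j)"
      have "(\<Sum>c\<in>{j\<in>{1..r}. k j > 0}. ?f c) = (\<Sum>c\<in>{j\<in>{1..r}. k j > 0}. B * (real (k c) / H' (T c)))"
        by (intro sum.cong remove) auto
      also have "\<dots> = (\<Sum>c\<in>{1..r}. B * (real (k c) / H' (T c)))"
        by (rule sum.mono_neutral_left) auto
      also have "\<dots> = B * Z" by (simp only: Z_def sum_distrib_left)
      finally have 1: "(\<Sum>c\<in>{j\<in>{1..r}. k j > 0}. ?f c) = B * Z" .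
      have 2: "?f 0 = B" unfolding B_def by (intro prod.cong) auto
      have "(\<Sum>c\<in>J. ?f c) = (\<Sum>c\<in>{j\<in>{1..r}. k j > 0}. ?f c) + (\<Sum>c\<in>(if Q \<subseteq> W then {} else {0}). ?f c)"
        unfolding J_def by (rule sum.union_disjoint) auto
      also have "(\<Sum>c\<in>(if Q \<subseteq> W then {} else {0}). ?f c) = B * \<eta>"
        using 2 by (simp add: \<eta>_def)
      finally show ?thesis unfolding 1 by (simp only: distrib_left add.commute)
    qed
    also have "B * (\<eta> + Z) * exp (H' (Q - W)) \<le> B * (\<eta> + Z) * (exp (M + 1) * ln (real N) * E)"
      using B0 Z0 by (intro mult_left_mono exp_uncoloured) (auto simp: \<eta>_def)
    finally have "real (card (?A - {1})) * ln (real N) \<le> K * real N * (B * (\<eta> + Z) * (exp (M + 1) * ln (real N) * E))"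
      using K(1) by (simp add: mult_left_mono)
    also have "\<dots> = (K * exp (M + 1) * (B * E * (\<eta> + Z)) * real N) * ln (real N)"
      by (simp only: mult_ac)
    finally have "real (card (?A - {1})) \<le> K * exp (M + 1) * (B * E * (\<eta> + Z)) * real N"
      using N by simp
    then have main: "real (card (?A - {1})) / real N \<le> K * exp (M + 1) * (B * E * (\<eta> + Z))"
      using N by (simp add: field_simps)

    \<comment> \<open>The integer \<open>1\<close> contributes \<open>1 / N\<close>. Here
      \<open>H W \<le> ln N\<close> without any additive constant, so this contribution is at most
      \<open>E\<close>.\<close>
    have "H (Q - W) \<ge> 0" unfolding H_def by (intro sum_nonneg) auto
    then have "H W \<le> ln (real N)"
      using H_primes_le_ln[of N] N HQ by (simp add: Q_def)
    then have "exp (- ln (real N)) \<le> E" by (simp add: E)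
    then have N_E: "1 / real N \<le> E" using N by (simp add: exp_minus field_simps)

    define P where "P = Px x (\<lambda>n. \<forall>j\<in>{1..r}. omegaT n (T j) = k j)"
    define \<xi> :: real where "\<xi> = (if \<eta> = 0 \<and> (\<forall>j\<in>{1..r}. k j = 0) then 1 else 0)"
    have P: "P = real (card ?A) / real N"
      by (simp add: P_def Px_def omega_class_def N_def)
    define X where "X = B * E * (\<eta> + Z)"
    have X0: "X \<ge> 0" using B0 E0 Z0 by (auto simp: X_def \<eta>_def)
    \<comment> \<open>The integer \<open>1\<close> is put back; it satisfies the constraints only if
      every \<open>k j\<close> is zero.\<close>
    have P_le: "P \<le> (C - 1) * X + (if \<forall>j\<in>{1..r}. k j = 0 then 1 / real N else 0)"
    proof (cases "1 \<in> ?A")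
      case True
      then have "\<forall>j\<in>{1..r}. k j = 0" by (auto simp: omega_class_def omegaT_1)
      moreover have "real (card ?A) = real (card (?A - {1})) + 1"
        using card_Suc_Diff1[OF finite_omega_class True] by linarith
      ultimately show ?thesis using main by (simp add: P C_def X_def add_divide_distrib)
    next
      case False
      then show ?thesis using main by (simp add: P C_def X_def add_increasing2)
    qed
    have k0: "B = 1" "Z = 0" if "\<forall>j\<in>{1..r}. k j = 0"
      using that by (simp_all add: B_def Z_def)
    have "P \<le> C * (B * E) * (\<eta> + Z) + C * \<xi>"
    proof -
      \<comment> \<open>If all \<open>k j\<close> vanish, then either \<open>\<eta> = 1\<close> and
        \<open>X = E \<ge> 1 / N\<close>, or \<open>\<eta> = 0\<close> and \<open>\<xi> = 1\<close>
        covers the term.\<close>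
      have "(if \<forall>j\<in>{1..r}. k j = 0 then 1 / real N else 0) \<le> X + \<xi>"
      proof (cases "(\<forall>j\<in>{1..r}. k j = 0) \<and> \<eta> \<noteq> 0")
        case True
        then show ?thesis using N_E k0 by (auto simp: X_def \<xi>_def \<eta>_def split: if_splits)
      next
        case False
        have "1 / real N \<le> 1" using N by simp
        then show ?thesis using False X0 by (auto simp: \<xi>_def)
      qed
      moreover have "\<xi> \<le> C * \<xi>" using C by (simp add: \<xi>_def)
      ultimately have "P \<le> C * X + C * \<xi>" using P_le by (simp add: algebra_simps)
      then show ?thesis by (simp add: X_def mult.assoc)
    qed
    moreover have "P \<le> C * (\<Prod>j=1..r. (H (T j) + 2) ^ k j / fact (k j) * exp (- H (T j)))"
    proof -
      \<comment> \<open>Replacing \<open>\<eta>\<close> by \<open>1\<close> makes the bound cover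
        \<open>n = 1\<close> without \<open>\<xi>\<close> and gives the factor \<open>1 + Z\<close>
        the shape required by \<open>prod_power_ge_linear\<close>.\<close>
      define Y where "Y = B * E * (1 + Z)"
      have "P \<le> C * Y"
      proof -
        have "(C - 1) * X \<le> (C - 1) * Y"
          unfolding X_def Y_def using C B0 E0 by (intro mult_left_mono) (auto simp: \<eta>_def)
        moreover have "(if \<forall>j\<in>{1..r}. k j = 0 then 1 / real N else 0) \<le> Y"
          using N_E k0 B0 E0 Z0 by (auto simp: Y_def)
        ultimately show ?thesis using P_le by (simp add: algebra_simps)
      qed
      also have "Y = (\<Prod>j=1..r. H' (T j) ^ k j) * (1 + Z) * (\<Prod>j=1..r. exp (- H (T j)) / fact (k j))"
        unfolding Y_def B_def E_def prod_dividef by (simp only: divide_inverse mult_ac)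
      also have "\<dots> \<le> (\<Prod>j=1..r. (H' (T j) + 1) ^ k j) * (\<Prod>j=1..r. exp (- H (T j)) / fact (k j))"
        unfolding Z_def using H'_pos by (intro mult_right_mono prod_power_ge_linear prod_nonneg) auto
      also have "\<dots> \<le> (\<Prod>j=1..r. (H (T j) + 2) ^ k j) * (\<Prod>j=1..r. exp (- H (T j)) / fact (k j))"
      proof (intro mult_right_mono prod_mono prod_nonneg conjI power_mono)
        fix j assume j: "j \<in> {1..r}"
        show "H' (T j) + 1 \<le> H (T j) + 2"
          using H'_le_H[OF finT[OF j] primeT[OF j]] by simp
        show "0 \<le> H' (T j) + 1" "0 \<le> (H' (T j) + 1) ^ k j" using H'_pos[OF j] by auto
      qed auto
      also have "\<dots> = (\<Prod>j=1..r. (H (T j) + 2) ^ k j / fact (k j) * exp (- H (T j)))"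
        unfolding prod.distrib prod_dividef by (simp only: divide_inverse mult_ac)
      finally show ?thesis using C by simp
    qed
    ultimately show "let P = Px x (\<lambda>n. \<forall>j\<in>{1..r}. omegaT n (T j) = k j);
             \<eta> = (if {p. prime p \<and> real p \<le> x} \<subseteq> (\<Union>j\<in>{1..r}. T j) then 0 else 1 :: real);
             \<xi> = (if \<eta> = 0 \<and> (\<forall>j\<in>{1..r}. k j = 0) then 1 else 0 :: real)
         in P \<le> C * (\<Prod>j=1..r. H' (T j) ^ k j / fact (k j) * exp (- H (T j)))
                  * (\<eta> + (\<Sum>j=1..r. real (k j) / H' (T j))) + C * \<xi>
          \<and> P \<le> C * (\<Prod>j=1..r. (H (T j) + 2) ^ k j / fact (k j) * exp (- H (T j)))"
      unfolding Let_def Q_eq BE W_def[symmetric] \<eta>_def[symmetric] Z_def[symmetric] \<xi>_def[symmetric] P_def[symmetric]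
      by blast
  qed
qed

end
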